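(* Let $X$ and $Y$ be doubly-degenerate $\mathbf{Bicat}_s$-categories, let $F,G\colon X\to Y$ be weak maps, and let $\theta\colon F\Rightarrow G$ be a $V$-transformation, that is, a vertically monoidal natural transformation. Then $\theta$ is an $H$-transformation, that is, $\theta$ is horizontally monoidal.
   Context: **Doubly-degenerate $\mathbf{Bicat}_s$-categories.** $\mathbf{Bicat}_s$ is the category of bicategories and strict functors (cartesian monoidal). A doubly-degenerate $\mathbf{Bicat}_s$-category is a $\mathbf{Bicat}_s$-enriched category with exactly one 0-cell and exactly one 1-cell. Equivalently, it is a category $X$ with: - a weak (vertical) monoidal structure with tensor $\frac{a}{b}$ and unit $1$; - a strict (horizontal) monoidal structure with tensor $a\,|\,b$ and the same unit $1$; such that $|\colon X\times X\to X$ and the unit $\mathbf 1\to X$ are strict monoidal functors for the vertical structure. In particular $\frac{a|b}{c|d}=\frac{a}{c}\big|\frac{b}{d}$ strictly. **Weak maps.** A weak map $(F,v,h)\colon X\to Y$ is a functor $F$ with natural isomorphisms $v_{a,b}\colon\frac{Fa}{Fb}\to F(\frac{a}{b})$ and $h_{a,b}\colon Fa|Fb\to F(a|b)$ and an isomorphism $\eta\colon1\to F1$ such that $(F,v,\eta)$ and $(F,h,\eta)$ are monoidal functors for the vertical and horizontal structures respectively, and $v_{a|b,c|d}\circ\frac{h_{a,b}}{h_{c,d}}=h_{\frac{a}{c},\frac{b}{d}}\circ(v_{a,c}|v_{b,d})$ for all $a,b,c,d$. **Transformations.** $V$ and $H$ denote the 2-monads for vertical and horizontal composition. For a natural transformation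 $\theta\colon F\Rightarrow G$ between such weak maps, being a $V$-transformation (vertically monoidal) means being a monoidal transformation $(F,v,\eta)\Rightarrow(G,v,\eta)$ for the vertical monoidal structures. Being an $H$-transformation (horizontally monoidal) means being a monoidal transformation $(F,h,\eta)\Rightarrow(G,h,\eta)$ for the horizontal monoidal structures. *)

theory Defs
  imports Main
begin

section \<open>Categories, functors and natural transformations\<close>

record ('o, 'm) cat =
  Obj :: "'o set"
  Arr :: "'m set"
  Dom :: "'m \<Rightarrow> 'o"
  Cod :: "'m \<Rightarrow> 'o"
  Ident :: "'o \<Rightarrow> 'm"
  Comp :: "'m \<Rightarrow> 'm \<Rightarrow> 'm"  (infixl "\<cdot>\<index>" 60)

text \<open>Composition is written in applicative order: \<open>g \<cdot>\<^bsub>C\<^esub> f\<close> is \<open>f\<close> followed by \<open>g\<close>.\<close>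

definition hom :: "('o, 'm) cat \<Rightarrow> 'o \<Rightarrow> 'o \<Rightarrow> 'm set" where
  "hom C a b = {f \<in> Arr C. Dom C f = a \<and> Cod C f = b}"

definition iso_arrow :: "('o, 'm) cat \<Rightarrow> 'm \<Rightarrow> bool" where
  "iso_arrow C f \<longleftrightarrow> f \<in> Arr C \<and>
     (\<exists>g \<in> hom C (Cod C f) (Dom C f).
        g \<cdot>\<^bsub>C\<^esub> f = Ident C (Dom C f) \<and> f \<cdot>\<^bsub>C\<^esub> g = Ident C (Cod C f))"

locale category =
  fixes C :: "('o, 'm) cat"
  assumes Dom_in_Obj: "f \<in> Arr C \<Longrightarrow> Dom C f \<in> Obj C"
    and Cod_in_Obj: "f \<in> Arr C \<Longrightarrow> Cod C f \<in> Obj C"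
    and Ident_in_hom: "a \<in> Obj C \<Longrightarrow> Ident C a \<in> hom C a a"
    and Comp_in_hom: "\<lbrakk>f \<in> hom C a b; g \<in> hom C b c\<rbrakk> \<Longrightarrow> g \<cdot>\<^bsub>C\<^esub> f \<in> hom C a c"
    and Comp_Ident: "f \<in> hom C a b \<Longrightarrow> f \<cdot>\<^bsub>C\<^esub> Ident C a = f"
    and Ident_Comp: "f \<in> hom C a b \<Longrightarrow> Ident C b \<cdot>\<^bsub>C\<^esub> f = f"
    and Comp_assoc:
      "\<lbrakk>f \<in> hom C a b; g \<in> hom C b c; k \<in> hom C c d\<rbrakk>
        \<Longrightarrow> (k \<cdot>\<^bsub>C\<^esub> g) \<cdot>\<^bsub>C\<^esub> f = k \<cdot>\<^bsub>C\<^esub> (g \<cdot>\<^bsub>C\<^esub> f)"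

definition prod_cat ::
  "('o, 'm) cat \<Rightarrow> ('p, 'n) cat \<Rightarrow> ('o \<times> 'p, 'm \<times> 'n) cat" where
  "prod_cat C D = \<lparr>
     Obj = Obj C \<times> Obj D,
     Arr = Arr C \<times> Arr D,
     Dom = map_prod (Dom C) (Dom D),
     Cod = map_prod (Cod C) (Cod D),
     Ident = map_prod (Ident C) (Ident D),
     Comp = (\<lambda>(g, g') (f, f'). (g \<cdot>\<^bsub>C\<^esub> f, g' \<cdot>\<^bsub>D\<^esub> f')) \<rparr>"

definition terminal_cat :: "(unit, unit) cat" where
  "terminal_cat = \<lparr>
     Obj = UNIV, Arr = UNIV, Dom = (\<lambda>_. ()), Cod = (\<lambda>_. ()),
     Ident = (\<lambda>_. ()), Comp = (\<lambda>_ _. ()) \<rparr>"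

record ('o, 'm, 'p, 'n) cat_map =
  on_obj :: "'o \<Rightarrow> 'p"
  on_arr :: "'m \<Rightarrow> 'n"

locale cat_functor = C: category C + D: category D
  for C :: "('o, 'm) cat" and D :: "('p, 'n) cat" +
  fixes F :: "('o, 'm, 'p, 'n) cat_map"
  assumes on_obj_in_Obj: "a \<in> Obj C \<Longrightarrow> on_obj F a \<in> Obj D"
    and on_arr_in_hom:
      "f \<in> hom C a b \<Longrightarrow> on_arr F f \<in> hom D (on_obj F a) (on_obj F b)"
    and on_arr_Ident: "a \<in> Obj C \<Longrightarrow> on_arr F (Ident C a) = Ident D (on_obj F a)"
    and on_arr_Comp:
      "\<lbrakk>f \<in> hom C a b; g \<in> hom C b c\<rbrakk>
        \<Longrightarrow> on_arr F (g \<cdot>\<^bsub>C\<^esub> f) = on_arr F g \<cdot>\<^bsub>D\<^esub> on_arr F f"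

locale nat_transformation = F: cat_functor C D F + G: cat_functor C D G
  for C :: "('o, 'm) cat" and D :: "('p, 'n) cat"
    and F G :: "('o, 'm, 'p, 'n) cat_map" +
  fixes \<theta> :: "'o \<Rightarrow> 'n"
  assumes component_in_hom: "a \<in> Obj C \<Longrightarrow> \<theta> a \<in> hom D (on_obj F a) (on_obj G a)"
    and naturality:
      "f \<in> hom C a b \<Longrightarrow> \<theta> b \<cdot>\<^bsub>D\<^esub> on_arr F f = on_arr G f \<cdot>\<^bsub>D\<^esub> \<theta> a"


section \<open>Monoidal categories\<close>

text \<open>The monoidal structure is kept apart from the underlying category, since one category will
  carry two of them.\<close>

record ('o, 'm) tensor_structure =
  tensor_obj :: "'o \<Rightarrow> 'o \<Rightarrow> 'o"  (infixl "\<otimes>\<index>" 70)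
  tensor_arr :: "'m \<Rightarrow> 'm \<Rightarrow> 'm"  (infixl "\<odot>\<index>" 70)
  unit_obj :: "'o"
  associator :: "'o \<Rightarrow> 'o \<Rightarrow> 'o \<Rightarrow> 'm"
  lunitor :: "'o \<Rightarrow> 'm"
  runitor :: "'o \<Rightarrow> 'm"

definition tensor_functor :: "('o, 'm) tensor_structure \<Rightarrow> ('o \<times> 'o, 'm \<times> 'm, 'o, 'm) cat_map" where
  "tensor_functor T = \<lparr>
     on_obj = (\<lambda>(a, b). a \<otimes>\<^bsub>T\<^esub> b),
     on_arr = (\<lambda>(f, g). f \<odot>\<^bsub>T\<^esub> g) \<rparr>"

locale monoidal_category =
  C: category C + tensor: cat_functor "prod_cat C C" C "tensor_functor T"
  for C :: "('o, 'm) cat" and T :: "('o, 'm) tensor_structure" (structure) +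
  assumes unit_in_Obj: "unit_obj T \<in> Obj C"
    and associator_in_hom:
      "\<lbrakk>a \<in> Obj C; b \<in> Obj C; c \<in> Obj C\<rbrakk>
        \<Longrightarrow> associator T a b c \<in> hom C ((a \<otimes> b) \<otimes> c) (a \<otimes> (b \<otimes> c))"
    and associator_iso:
      "\<lbrakk>a \<in> Obj C; b \<in> Obj C; c \<in> Obj C\<rbrakk> \<Longrightarrow> iso_arrow C (associator T a b c)"
    and associator_natural:
      "\<lbrakk>f \<in> hom C a a'; g \<in> hom C b b'; k \<in> hom C c c'\<rbrakk>
        \<Longrightarrow> associator T a' b' c' \<cdot>\<^bsub>C\<^esub> ((f \<odot> g) \<odot> k)
            = (f \<odot> (g \<odot> k)) \<cdot>\<^bsub>C\<^esub> associator T a b c"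
    and lunitor_in_hom: "a \<in> Obj C \<Longrightarrow> lunitor T a \<in> hom C (unit_obj T \<otimes> a) a"
    and lunitor_iso: "a \<in> Obj C \<Longrightarrow> iso_arrow C (lunitor T a)"
    and lunitor_natural:
      "f \<in> hom C a b
        \<Longrightarrow> lunitor T b \<cdot>\<^bsub>C\<^esub> (Ident C (unit_obj T) \<odot> f) = f \<cdot>\<^bsub>C\<^esub> lunitor T a"
    and runitor_in_hom: "a \<in> Obj C \<Longrightarrow> runitor T a \<in> hom C (a \<otimes> unit_obj T) a"
    and runitor_iso: "a \<in> Obj C \<Longrightarrow> iso_arrow C (runitor T a)"
    and runitor_natural:
      "f \<in> hom C a b
        \<Longrightarrow> runitor T b \<cdot>\<^bsub>C\<^esub> (f \<odot> Ident C (unit_obj T)) = f \<cdot>\<^bsub>C\<^esub> runitor T a"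
    and pentagon:
      "\<lbrakk>a \<in> Obj C; b \<in> Obj C; c \<in> Obj C; d \<in> Obj C\<rbrakk>
        \<Longrightarrow> associator T a b (c \<otimes> d) \<cdot>\<^bsub>C\<^esub> associator T (a \<otimes> b) c d
            = (Ident C a \<odot> associator T b c d) \<cdot>\<^bsub>C\<^esub> associator T a (b \<otimes> c) d
                \<cdot>\<^bsub>C\<^esub> (associator T a b c \<odot> Ident C d)"
    and triangle:
      "\<lbrakk>a \<in> Obj C; b \<in> Obj C\<rbrakk>
        \<Longrightarrow> (Ident C a \<odot> lunitor T b) \<cdot>\<^bsub>C\<^esub> associator T a (unit_obj T) b
            = runitor T a \<odot> Ident C b"

text \<open>Since the constraint isomorphisms have prescribed domains and codomains, requiring them to be
  identities forces the tensor product to be strictly associative and unital, on objects by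
  comparing domains and on arrows by naturality.\<close>

locale strict_monoidal_category = monoidal_category C T
  for C :: "('o, 'm) cat" and T :: "('o, 'm) tensor_structure" (structure) +
  assumes associator_strict:
      "\<lbrakk>a \<in> Obj C; b \<in> Obj C; c \<in> Obj C\<rbrakk> \<Longrightarrow> associator T a b c = Ident C (a \<otimes> (b \<otimes> c))"
    and lunitor_strict: "a \<in> Obj C \<Longrightarrow> lunitor T a = Ident C a"
    and runitor_strict: "a \<in> Obj C \<Longrightarrow> runitor T a = Ident C a"

definition prod_tensor ::
  "('o, 'm) tensor_structure \<Rightarrow> ('p, 'n) tensor_structure
    \<Rightarrow> ('o \<times> 'p, 'm \<times> 'n) tensor_structure" where
  "prod_tensor S T = \<lparr>
     tensor_obj = (\<lambda>(a, a') (b, b'). (a \<otimes>\<^bsub>S\<^esub> b, a' \<otimes>\<^bsub>T\<^esub> b')),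
     tensor_arr = (\<lambda>(f, f') (g, g'). (f \<odot>\<^bsub>S\<^esub> g, f' \<odot>\<^bsub>T\<^esub> g')),
     unit_obj = (unit_obj S, unit_obj T),
     associator = (\<lambda>(a, a') (b, b') (c, c'). (associator S a b c, associator T a' b' c')),
     lunitor = map_prod (lunitor S) (lunitor T),
     runitor = map_prod (runitor S) (runitor T) \<rparr>"

definition terminal_tensor :: "(unit, unit) tensor_structure" where
  "terminal_tensor = \<lparr>
     tensor_obj = (\<lambda>_ _. ()), tensor_arr = (\<lambda>_ _. ()), unit_obj = (),
     associator = (\<lambda>_ _ _. ()), lunitor = (\<lambda>_. ()), runitor = (\<lambda>_. ()) \<rparr>"

locale strict_monoidal_functor =
  C: monoidal_category C S + D: monoidal_category D T + cat_functor C D F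
  for C :: "('o, 'm) cat" and S :: "('o, 'm) tensor_structure"
    and D :: "('p, 'n) cat" and T :: "('p, 'n) tensor_structure"
    and F :: "('o, 'm, 'p, 'n) cat_map" +
  assumes strict_tensor_obj:
      "\<lbrakk>a \<in> Obj C; b \<in> Obj C\<rbrakk> \<Longrightarrow> on_obj F (a \<otimes>\<^bsub>S\<^esub> b) = on_obj F a \<otimes>\<^bsub>T\<^esub> on_obj F b"
    and strict_tensor_arr:
      "\<lbrakk>f \<in> Arr C; g \<in> Arr C\<rbrakk> \<Longrightarrow> on_arr F (f \<odot>\<^bsub>S\<^esub> g) = on_arr F f \<odot>\<^bsub>T\<^esub> on_arr F g"
    and strict_unit: "on_obj F (unit_obj S) = unit_obj T"
    and strict_associator:
      "\<lbrakk>a \<in> Obj C; b \<in> Obj C; c \<in> Obj C\<rbrakk>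
        \<Longrightarrow> on_arr F (associator S a b c)
            = associator T (on_obj F a) (on_obj F b) (on_obj F c)"
    and strict_lunitor: "a \<in> Obj C \<Longrightarrow> on_arr F (lunitor S a) = lunitor T (on_obj F a)"
    and strict_runitor: "a \<in> Obj C \<Longrightarrow> on_arr F (runitor S a) = runitor T (on_obj F a)"

text \<open>A (strong) monoidal functor \<open>(F, \<mu>, \<eta>)\<close>, with invertible comparison maps
  \<open>\<mu> a b : F a \<otimes> F b \<rightarrow> F (a \<otimes> b)\<close> and \<open>\<eta> : 1 \<rightarrow> F 1\<close>.\<close>

locale monoidal_functor =
  C: monoidal_category C S + D: monoidal_category D T + cat_functor C D F
  for C :: "('o, 'm) cat" and S :: "('o, 'm) tensor_structure"
    and D :: "('p, 'n) cat" and T :: "('p, 'n) tensor_structure"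
    and F :: "('o, 'm, 'p, 'n) cat_map" +
  fixes \<mu> :: "'o \<Rightarrow> 'o \<Rightarrow> 'n" and \<eta> :: "'n"
  assumes mult_in_hom:
      "\<lbrakk>a \<in> Obj C; b \<in> Obj C\<rbrakk>
        \<Longrightarrow> \<mu> a b \<in> hom D (on_obj F a \<otimes>\<^bsub>T\<^esub> on_obj F b) (on_obj F (a \<otimes>\<^bsub>S\<^esub> b))"
    and mult_iso: "\<lbrakk>a \<in> Obj C; b \<in> Obj C\<rbrakk> \<Longrightarrow> iso_arrow D (\<mu> a b)"
    and mult_natural:
      "\<lbrakk>f \<in> hom C a a'; g \<in> hom C b b'\<rbrakk>
        \<Longrightarrow> \<mu> a' b' \<cdot>\<^bsub>D\<^esub> (on_arr F f \<odot>\<^bsub>T\<^esub> on_arr F g) = on_arr F (f \<odot>\<^bsub>S\<^esub> g) \<cdot>\<^bsub>D\<^esub> \<mu> a b"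
    and unit_in_hom: "\<eta> \<in> hom D (unit_obj T) (on_obj F (unit_obj S))"
    and unit_iso: "iso_arrow D \<eta>"
    and mult_associative:
      "\<lbrakk>a \<in> Obj C; b \<in> Obj C; c \<in> Obj C\<rbrakk>
        \<Longrightarrow> on_arr F (associator S a b c) \<cdot>\<^bsub>D\<^esub> \<mu> (a \<otimes>\<^bsub>S\<^esub> b) c
                \<cdot>\<^bsub>D\<^esub> (\<mu> a b \<odot>\<^bsub>T\<^esub> Ident D (on_obj F c))
            = \<mu> a (b \<otimes>\<^bsub>S\<^esub> c) \<cdot>\<^bsub>D\<^esub> (Ident D (on_obj F a) \<odot>\<^bsub>T\<^esub> \<mu> b c)
                \<cdot>\<^bsub>D\<^esub> associator T (on_obj F a) (on_obj F b) (on_obj F c)"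
    and mult_lunit:
      "a \<in> Obj C
        \<Longrightarrow> on_arr F (lunitor S a) \<cdot>\<^bsub>D\<^esub> \<mu> (unit_obj S) a
                \<cdot>\<^bsub>D\<^esub> (\<eta> \<odot>\<^bsub>T\<^esub> Ident D (on_obj F a))
            = lunitor T (on_obj F a)"
    and mult_runit:
      "a \<in> Obj C
        \<Longrightarrow> on_arr F (runitor S a) \<cdot>\<^bsub>D\<^esub> \<mu> a (unit_obj S)
                \<cdot>\<^bsub>D\<^esub> (Ident D (on_obj F a) \<odot>\<^bsub>T\<^esub> \<eta>)
            = runitor T (on_obj F a)"

locale monoidal_transformation =
  F: monoidal_functor C S D T F \<mu> \<eta> + G: monoidal_functor C S D T G \<nu> \<zeta>
    + nat_transformation C D F G \<theta>
  for C :: "('o, 'm) cat" and S :: "('o, 'm) tensor_structure"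
    and D :: "('p, 'n) cat" and T :: "('p, 'n) tensor_structure"
    and F :: "('o, 'm, 'p, 'n) cat_map" and \<mu> :: "'o \<Rightarrow> 'o \<Rightarrow> 'n" and \<eta> :: "'n"
    and G :: "('o, 'm, 'p, 'n) cat_map" and \<nu> :: "'o \<Rightarrow> 'o \<Rightarrow> 'n" and \<zeta> :: "'n"
    and \<theta> :: "'o \<Rightarrow> 'n" +
  assumes respects_mult:
      "\<lbrakk>a \<in> Obj C; b \<in> Obj C\<rbrakk>
        \<Longrightarrow> \<theta> (a \<otimes>\<^bsub>S\<^esub> b) \<cdot>\<^bsub>D\<^esub> \<mu> a b = \<nu> a b \<cdot>\<^bsub>D\<^esub> (\<theta> a \<odot>\<^bsub>T\<^esub> \<theta> b)"
    and respects_unit: "\<theta> (unit_obj S) \<cdot>\<^bsub>D\<^esub> \<eta> = \<zeta>"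


section \<open>Doubly-degenerate categories enriched in bicategories and strict functors\<close>

text \<open>The sole hom-bicategory has one 0-cell; \<open>base\<close> is its category of 1-cells and 2-cells (that
  is, of 2-cells and 3-cells of the enriched category), \<open>vert\<close> is composition inside this
  bicategory and \<open>horiz\<close> is enriched composition.\<close>

record ('o, 'm) dd_structure =
  base :: "('o, 'm) cat"
  vert :: "('o, 'm) tensor_structure"
  horiz :: "('o, 'm) tensor_structure"

locale dd_Bicat\<^sub>s_category =
  fixes X :: "('o, 'm) dd_structure"
  assumes vert_monoidal: "monoidal_category (base X) (vert X)"
    and horiz_strict_monoidal: "strict_monoidal_category (base X) (horiz X)"
    and same_unit: "unit_obj (horiz X) = unit_obj (vert X)"
    and horiz_tensor_strict_monoidal:
      "strict_monoidal_functor
         (prod_cat (base X) (base X)) (prod_tensor (vert X) (vert X))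
         (base X) (vert X)
         (tensor_functor (horiz X))"
    and horiz_unit_strict_monoidal:
      "strict_monoidal_functor
         terminal_cat terminal_tensor
         (base X) (vert X)
         \<lparr>on_obj = (\<lambda>_. unit_obj (horiz X)), on_arr = (\<lambda>_. Ident (base X) (unit_obj (horiz X)))\<rparr>"

record ('o, 'm, 'p, 'n) weak_map_data =
  underlying :: "('o, 'm, 'p, 'n) cat_map"
  vmult :: "'o \<Rightarrow> 'o \<Rightarrow> 'n"
  hmult :: "'o \<Rightarrow> 'o \<Rightarrow> 'n"
  unit_map :: "'n"

locale weak_map = X: dd_Bicat\<^sub>s_category X + Y: dd_Bicat\<^sub>s_category Y
  for X :: "('o, 'm) dd_structure" and Y :: "('p, 'n) dd_structure" +
  fixes F :: "('o, 'm, 'p, 'n) weak_map_data"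
  assumes vert_monoidal_functor:
      "monoidal_functor (base X) (vert X) (base Y) (vert Y)
         (underlying F) (vmult F) (unit_map F)"
    and horiz_monoidal_functor:
      "monoidal_functor (base X) (horiz X) (base Y) (horiz Y)
         (underlying F) (hmult F) (unit_map F)"
    and mult_interchange:
      "\<lbrakk>a \<in> Obj (base X); b \<in> Obj (base X); c \<in> Obj (base X); d \<in> Obj (base X)\<rbrakk>
        \<Longrightarrow> vmult F (a \<otimes>\<^bsub>horiz X\<^esub> b) (c \<otimes>\<^bsub>horiz X\<^esub> d)
              \<cdot>\<^bsub>base Y\<^esub> (hmult F a b \<odot>\<^bsub>vert Y\<^esub> hmult F c d)
            = hmult F (a \<otimes>\<^bsub>vert X\<^esub> c) (b \<otimes>\<^bsub>vert X\<^esub> d)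
              \<cdot>\<^bsub>base Y\<^esub> (vmult F a c \<odot>\<^bsub>horiz Y\<^esub> vmult F b d)"

definition V_transformation ::
  "('o, 'm) dd_structure \<Rightarrow> ('p, 'n) dd_structure
    \<Rightarrow> ('o, 'm, 'p, 'n) weak_map_data \<Rightarrow> ('o, 'm, 'p, 'n) weak_map_data
    \<Rightarrow> ('o \<Rightarrow> 'n) \<Rightarrow> bool" where
  "V_transformation X Y F G \<theta> \<longleftrightarrow>
     monoidal_transformation (base X) (vert X) (base Y) (vert Y)
       (underlying F) (vmult F) (unit_map F)
       (underlying G) (vmult G) (unit_map G) \<theta>"

definition H_transformation ::
  "('o, 'm) dd_structure \<Rightarrow> ('p, 'n) dd_structure
    \<Rightarrow> ('o, 'm, 'p, 'n) weak_map_data \<Rightarrow> ('o, 'm, 'p, 'n) weak_map_data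
    \<Rightarrow> ('o \<Rightarrow> 'n) \<Rightarrow> bool" where
  "H_transformation X Y F G \<theta> \<longleftrightarrow>
     monoidal_transformation (base X) (horiz X) (base Y) (horiz Y)
       (underlying F) (hmult F) (unit_map F)
       (underlying G) (hmult G) (unit_map G) \<theta>"

end

theory Submission
  imports Defs
begin

text \<open>The horizontal comparison maps of a weak map are determined by its vertical ones, by an
  Eckmann--Hilton argument. Write \<open>a/b\<close> for the vertical and \<open>a|b\<close> for the horizontal tensor. As
  the horizontal structure is strict, shares its unit with the vertical one and satisfies strict
  interchange, \<open>a/b = (a|1)/(1|b) = (a/1)|(1/b)\<close>, on objects and on arrows. The vertical unit
  constraints therefore induce an isomorphism \<open>r\<^sub>a|l\<^sub>b : a/b \<rightarrow> a|b\<close>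
  (\<open>vert_to_horiz\<close>), natural in \<open>a\<close> and \<open>b\<close>.

  For a weak map \<open>(F, v, h)\<close> this isomorphism carries \<open>v\<close> to \<open>h\<close>:
  \<open>h\<^sub>a\<^sub>b \<circ> (r|l) = F (r|l) \<circ> v\<^sub>a\<^sub>b\<close>
  (\<open>hmult_vert_to_horiz\<close>). So if \<open>\<theta> : F \<Rightarrow> G\<close> is natural and compatible with the maps \<open>v\<close>,
  then it is compatible with the maps \<open>h\<close> after precomposition with the isomorphism \<open>r|l\<close>, which
  cancels. The two unit conditions on \<open>\<theta>\<close> agree because the
  two tensors share their unit and \<open>F\<close>, \<open>G\<close> each have a single unit comparison map.\<close>

section \<open>Generalities on categories and monoidal categories\<close>

lemma (in category) hom_Obj:
  assumes "f \<in> hom C a b" shows "a \<in> Obj C" "b \<in> Obj C" "f \<in> Arr C"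
  using assms Dom_in_Obj Cod_in_Obj by (auto simp: hom_def)

lemma (in category) iso_arrow_epi:
  assumes "iso_arrow C f" "f \<in> hom C a b" "p \<in> hom C b c" "q \<in> hom C b c"
    and eq: "p \<cdot>\<^bsub>C\<^esub> f = q \<cdot>\<^bsub>C\<^esub> f"
  shows "p = q"
proof -
  obtain g where g: "g \<in> hom C b a" "f \<cdot>\<^bsub>C\<^esub> g = Ident C b"
    using assms(1,2) unfolding iso_arrow_def hom_def by auto
  have "p = (p \<cdot>\<^bsub>C\<^esub> f) \<cdot>\<^bsub>C\<^esub> g"
    using Comp_assoc[OF g(1) assms(2,3)] g(2) Comp_Ident[OF assms(3)] by simp
  also have "\<dots> = q"
    using Comp_assoc[OF g(1) assms(2,4)] g(2) Comp_Ident[OF assms(4)] eq by simp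
  finally show ?thesis .
qed

context monoidal_category
begin

lemma tensor_in_Obj: "\<lbrakk>a \<in> Obj C; b \<in> Obj C\<rbrakk> \<Longrightarrow> a \<otimes> b \<in> Obj C"
  using tensor.on_obj_in_Obj[of "(a, b)"] by (simp add: tensor_functor_def prod_cat_def)

lemma tensor_in_hom:
  assumes "f \<in> hom C a b" "g \<in> hom C c d"
  shows "f \<odot> g \<in> hom C (a \<otimes> c) (b \<otimes> d)"
  using tensor.on_arr_in_hom[of "(f, g)" "(a, c)" "(b, d)"] assms
  by (auto simp: tensor_functor_def prod_cat_def hom_def)

lemma tensor_Ident:
  assumes "a \<in> Obj C" "b \<in> Obj C"
  shows "Ident C a \<odot> Ident C b = Ident C (a \<otimes> b)"
  using tensor.on_arr_Ident[of "(a, b)"] assms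
  by (simp add: tensor_functor_def prod_cat_def)

lemma tensor_Comp:
  assumes "f \<in> hom C a b" "g \<in> hom C b c" "f' \<in> hom C a' b'" "g' \<in> hom C b' c'"
  shows "(g \<odot> g') \<cdot>\<^bsub>C\<^esub> (f \<odot> f') = (g \<cdot>\<^bsub>C\<^esub> f) \<odot> (g' \<cdot>\<^bsub>C\<^esub> f')"
  using tensor.on_arr_Comp[of "(f, f')" "(a, a')" "(b, b')" "(g, g')" "(c, c')"] assms
  by (auto simp: tensor_functor_def prod_cat_def hom_def)

lemma tensor_iso:
  assumes "iso_arrow C f" "iso_arrow C g"
  shows "iso_arrow C (f \<odot> g)"
proof -
  obtain a b where f: "f \<in> hom C a b" using assms(1) by (auto simp: iso_arrow_def hom_def)
  obtain c d where g: "g \<in> hom C c d" using assms(2) by (auto simp: iso_arrow_def hom_def)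
  obtain f' where f': "f' \<in> hom C b a" "f' \<cdot>\<^bsub>C\<^esub> f = Ident C a" "f \<cdot>\<^bsub>C\<^esub> f' = Ident C b"
    using assms(1) f unfolding iso_arrow_def hom_def by auto
  obtain g' where g': "g' \<in> hom C d c" "g' \<cdot>\<^bsub>C\<^esub> g = Ident C c" "g \<cdot>\<^bsub>C\<^esub> g' = Ident C d"
    using assms(2) g unfolding iso_arrow_def hom_def by auto
  have fg: "f \<odot> g \<in> hom C (a \<otimes> c) (b \<otimes> d)" by (rule tensor_in_hom[OF f g])
  have "f' \<odot> g' \<in> hom C (b \<otimes> d) (a \<otimes> c)" by (rule tensor_in_hom[OF f'(1) g'(1)])
  moreover have "(f' \<odot> g') \<cdot>\<^bsub>C\<^esub> (f \<odot> g) = Ident C (a \<otimes> c)"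
    using tensor_Comp[OF f f'(1) g g'(1)] f'(2) g'(2)
      tensor_Ident C.hom_Obj[OF f] C.hom_Obj[OF g] by simp
  moreover have "(f \<odot> g) \<cdot>\<^bsub>C\<^esub> (f' \<odot> g') = Ident C (b \<otimes> d)"
    using tensor_Comp[OF f'(1) f g'(1) g] f'(3) g'(3)
      tensor_Ident C.hom_Obj[OF f] C.hom_Obj[OF g] by simp
  ultimately show ?thesis
    using fg unfolding iso_arrow_def hom_def by auto
qed

end

context strict_monoidal_category
begin

text \<open>Strictness on objects is read off from the endpoints of the unit constraints, strictness on
  arrows from their naturality.\<close>

lemma strict_unit_obj:
  assumes "a \<in> Obj C"
  shows "unit_obj T \<otimes> a = a" "a \<otimes> unit_obj T = a"
  using lunitor_in_hom[OF assms] runitor_in_hom[OF assms] lunitor_strict[OF assms]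
    runitor_strict[OF assms] C.Ident_in_hom[OF assms]
  by (auto simp: hom_def)

lemma strict_unit_arr:
  assumes f: "f \<in> hom C a b"
  shows "Ident C (unit_obj T) \<odot> f = f" "f \<odot> Ident C (unit_obj T) = f"
proof -
  note ab = C.hom_Obj[OF f]
  have 1: "Ident C (unit_obj T) \<in> hom C (unit_obj T) (unit_obj T)"
    by (rule C.Ident_in_hom[OF unit_in_Obj])
  have l: "Ident C (unit_obj T) \<odot> f \<in> hom C a b"
    using tensor_in_hom[OF 1 f] ab by (simp add: strict_unit_obj)
  have r: "f \<odot> Ident C (unit_obj T) \<in> hom C a b"
    using tensor_in_hom[OF f 1] ab by (simp add: strict_unit_obj)
  show "Ident C (unit_obj T) \<odot> f = f"
    using lunitor_natural[OF f] ab C.Ident_Comp[OF l] C.Comp_Ident[OF f]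
    by (simp add: lunitor_strict)
  show "f \<odot> Ident C (unit_obj T) = f"
    using runitor_natural[OF f] ab C.Ident_Comp[OF r] C.Comp_Ident[OF f]
    by (simp add: runitor_strict)
qed

end

section \<open>Comparing the two tensor products\<close>

context dd_Bicat\<^sub>s_category
begin

interpretation V: monoidal_category "base X" "vert X" by (rule vert_monoidal)
interpretation H: strict_monoidal_category "base X" "horiz X" by (rule horiz_strict_monoidal)

abbreviation one :: 'o where "one \<equiv> unit_obj (vert X)"

lemma interchange_obj:
  assumes "a \<in> Obj (base X)" "b \<in> Obj (base X)" "c \<in> Obj (base X)" "d \<in> Obj (base X)"
  shows "(a \<otimes>\<^bsub>horiz X\<^esub> b) \<otimes>\<^bsub>vert X\<^esub> (c \<otimes>\<^bsub>horiz X\<^esub> d)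
       = (a \<otimes>\<^bsub>vert X\<^esub> c) \<otimes>\<^bsub>horiz X\<^esub> (b \<otimes>\<^bsub>vert X\<^esub> d)"
  using strict_monoidal_functor.strict_tensor_obj[OF horiz_tensor_strict_monoidal,
      of "(a, b)" "(c, d)"] assms
  by (simp add: prod_cat_def prod_tensor_def tensor_functor_def)

lemma interchange_arr:
  assumes "f \<in> Arr (base X)" "g \<in> Arr (base X)" "k \<in> Arr (base X)" "l \<in> Arr (base X)"
  shows "(f \<odot>\<^bsub>horiz X\<^esub> g) \<odot>\<^bsub>vert X\<^esub> (k \<odot>\<^bsub>horiz X\<^esub> l)
       = (f \<odot>\<^bsub>vert X\<^esub> k) \<odot>\<^bsub>horiz X\<^esub> (g \<odot>\<^bsub>vert X\<^esub> l)"
  using strict_monoidal_functor.strict_tensor_arr[OF horiz_tensor_strict_monoidal,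
      of "(f, g)" "(k, l)"] assms
  by (simp add: prod_cat_def prod_tensor_def tensor_functor_def)

text \<open>The Eckmann--Hilton decomposition: pad both factors with horizontal units, then apply
  interchange.\<close>

lemma vert_eq_horiz_obj:
  assumes "a \<in> Obj (base X)" "b \<in> Obj (base X)"
  shows "a \<otimes>\<^bsub>vert X\<^esub> b = (a \<otimes>\<^bsub>vert X\<^esub> one) \<otimes>\<^bsub>horiz X\<^esub> (one \<otimes>\<^bsub>vert X\<^esub> b)"
  using interchange_obj[of a one one b] assms V.unit_in_Obj
    H.strict_unit_obj(2)[of a] H.strict_unit_obj(1)[of b] by (simp add: same_unit)

lemma vert_eq_horiz_arr:
  assumes "f \<in> hom (base X) a a'" "g \<in> hom (base X) b b'"
  shows "f \<odot>\<^bsub>vert X\<^esub> g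
       = (f \<odot>\<^bsub>vert X\<^esub> Ident (base X) one) \<odot>\<^bsub>horiz X\<^esub> (Ident (base X) one \<odot>\<^bsub>vert X\<^esub> g)"
  using interchange_arr[of f "Ident (base X) one" "Ident (base X) one" g]
    V.C.hom_Obj[OF assms(1)] V.C.hom_Obj[OF assms(2)]
    V.C.hom_Obj[OF V.C.Ident_in_hom[OF V.unit_in_Obj]]
    H.strict_unit_arr(2)[OF assms(1)] H.strict_unit_arr(1)[OF assms(2)]
  by (simp add: same_unit)

definition vert_to_horiz :: "'o \<Rightarrow> 'o \<Rightarrow> 'm" where
  "vert_to_horiz a b = runitor (vert X) a \<odot>\<^bsub>horiz X\<^esub> lunitor (vert X) b"

lemma vert_to_horiz_in_hom:
  assumes "a \<in> Obj (base X)" "b \<in> Obj (base X)"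
  shows "vert_to_horiz a b \<in> hom (base X) (a \<otimes>\<^bsub>vert X\<^esub> b) (a \<otimes>\<^bsub>horiz X\<^esub> b)"
  using H.tensor_in_hom[OF V.runitor_in_hom[OF assms(1)] V.lunitor_in_hom[OF assms(2)]]
  unfolding vert_to_horiz_def vert_eq_horiz_obj[OF assms, symmetric] .

lemma vert_to_horiz_iso:
  assumes "a \<in> Obj (base X)" "b \<in> Obj (base X)"
  shows "iso_arrow (base X) (vert_to_horiz a b)"
  unfolding vert_to_horiz_def
  by (rule H.tensor_iso[OF V.runitor_iso[OF assms(1)] V.lunitor_iso[OF assms(2)]])

lemma vert_to_horiz_natural:
  assumes f: "f \<in> hom (base X) a a'" and g: "g \<in> hom (base X) b b'"
  shows "vert_to_horiz a' b' \<cdot>\<^bsub>base X\<^esub> (f \<odot>\<^bsub>vert X\<^esub> g)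
       = (f \<odot>\<^bsub>horiz X\<^esub> g) \<cdot>\<^bsub>base X\<^esub> vert_to_horiz a b"
proof -
  note a = V.C.hom_Obj(1,2)[OF f] and b = V.C.hom_Obj(1,2)[OF g]
  note 1 = V.C.Ident_in_hom[OF V.unit_in_Obj]
  have "vert_to_horiz a' b' \<cdot>\<^bsub>base X\<^esub> (f \<odot>\<^bsub>vert X\<^esub> g)
      = (runitor (vert X) a' \<cdot>\<^bsub>base X\<^esub> (f \<odot>\<^bsub>vert X\<^esub> Ident (base X) one))
        \<odot>\<^bsub>horiz X\<^esub> (lunitor (vert X) b' \<cdot>\<^bsub>base X\<^esub> (Ident (base X) one \<odot>\<^bsub>vert X\<^esub> g))"
    unfolding vert_to_horiz_def vert_eq_horiz_arr[OF f g]
    by (rule H.tensor_Comp[OF V.tensor_in_hom[OF f 1] V.runitor_in_hom[OF a(2)]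
          V.tensor_in_hom[OF 1 g] V.lunitor_in_hom[OF b(2)]])
  also have "\<dots> = (f \<cdot>\<^bsub>base X\<^esub> runitor (vert X) a) \<odot>\<^bsub>horiz X\<^esub> (g \<cdot>\<^bsub>base X\<^esub> lunitor (vert X) b)"
    by (simp add: V.runitor_natural[OF f] V.lunitor_natural[OF g])
  also have "\<dots> = (f \<odot>\<^bsub>horiz X\<^esub> g) \<cdot>\<^bsub>base X\<^esub> vert_to_horiz a b"
    unfolding vert_to_horiz_def
    by (rule H.tensor_Comp[OF V.runitor_in_hom[OF a(1)] f V.lunitor_in_hom[OF b(1)] g, symmetric])
  finally show ?thesis .
qed

end

section \<open>Weak maps and their transformations\<close>

context weak_map
begin

interpretation XV: monoidal_category "base X" "vert X" by (rule X.vert_monoidal)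
interpretation XH: strict_monoidal_category "base X" "horiz X" by (rule X.horiz_strict_monoidal)
interpretation YV: monoidal_category "base Y" "vert Y" by (rule Y.vert_monoidal)
interpretation YH: strict_monoidal_category "base Y" "horiz Y" by (rule Y.horiz_strict_monoidal)
interpretation FV: monoidal_functor "base X" "vert X" "base Y" "vert Y"
    "underlying F" "vmult F" "unit_map F"
  by (rule vert_monoidal_functor)
interpretation FH: monoidal_functor "base X" "horiz X" "base Y" "horiz Y"
    "underlying F" "hmult F" "unit_map F"
  by (rule horiz_monoidal_functor)

text \<open>Because the horizontal unit constraints are identities, the unit axioms of \<open>F\<close> say that
  \<open>hmult F\<close> with one argument the unit is inverse to tensoring with \<open>unit_map F\<close>.\<close>

lemma hmult_unit:
  assumes a: "a \<in> Obj (base X)"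
  shows "hmult F a X.one \<cdot>\<^bsub>base Y\<^esub> (Ident (base Y) (on_obj (underlying F) a) \<odot>\<^bsub>horiz Y\<^esub> unit_map F)
           = Ident (base Y) (on_obj (underlying F) a)"
    and "hmult F X.one a \<cdot>\<^bsub>base Y\<^esub> (unit_map F \<odot>\<^bsub>horiz Y\<^esub> Ident (base Y) (on_obj (underlying F) a))
           = Ident (base Y) (on_obj (underlying F) a)"
proof -
  let ?Fa = "on_obj (underlying F) a"
  note u = XH.unit_in_Obj and Fa = FV.on_obj_in_Obj[OF a]
  have r: "hmult F a (unit_obj (horiz X)) \<in> hom (base Y)
      (?Fa \<otimes>\<^bsub>horiz Y\<^esub> on_obj (underlying F) (unit_obj (horiz X))) ?Fa"
    using FH.mult_in_hom[OF a u] XH.strict_unit_obj(2)[OF a] by simp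
  have l: "hmult F (unit_obj (horiz X)) a \<in> hom (base Y)
      (on_obj (underlying F) (unit_obj (horiz X)) \<otimes>\<^bsub>horiz Y\<^esub> ?Fa) ?Fa"
    using FH.mult_in_hom[OF u a] XH.strict_unit_obj(1)[OF a] by simp
  show "hmult F a X.one \<cdot>\<^bsub>base Y\<^esub> (Ident (base Y) ?Fa \<odot>\<^bsub>horiz Y\<^esub> unit_map F) = Ident (base Y) ?Fa"
    using FH.mult_runit[OF a] YV.C.Ident_Comp[OF r]
    by (simp add: XH.runitor_strict[OF a] YH.runitor_strict[OF Fa] FV.on_arr_Ident[OF a]
        X.same_unit)
  show "hmult F X.one a \<cdot>\<^bsub>base Y\<^esub> (unit_map F \<odot>\<^bsub>horiz Y\<^esub> Ident (base Y) ?Fa) = Ident (base Y) ?Fa"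
    using FH.mult_lunit[OF a] YV.C.Ident_Comp[OF l]
    by (simp add: XH.lunitor_strict[OF a] YH.lunitor_strict[OF Fa] FV.on_arr_Ident[OF a]
        X.same_unit)
qed

text \<open>The interchange axiom at \<open>a, 1, 1, b\<close>, with the unit maps \<open>1 \<rightarrow> F 1\<close> inserted: the horizontal
  unit axioms cancel the maps \<open>hmult F a 1\<close> and \<open>hmult F 1 b\<close> and only \<open>vmult F a b\<close> is left.\<close>

lemma hmult_padded_eq_vmult:
  assumes a: "a \<in> Obj (base X)" and b: "b \<in> Obj (base X)"
  defines "Fa \<equiv> on_obj (underlying F) a" and "Fb \<equiv> on_obj (underlying F) b"
  shows "hmult F (a \<otimes>\<^bsub>vert X\<^esub> X.one) (X.one \<otimes>\<^bsub>vert X\<^esub> b) \<cdot>\<^bsub>base Y\<^esub>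
           ((vmult F a X.one \<cdot>\<^bsub>base Y\<^esub> (Ident (base Y) Fa \<odot>\<^bsub>vert Y\<^esub> unit_map F)) \<odot>\<^bsub>horiz Y\<^esub>
            (vmult F X.one b \<cdot>\<^bsub>base Y\<^esub> (unit_map F \<odot>\<^bsub>vert Y\<^esub> Ident (base Y) Fb)))
         = vmult F a b"
    (is "?h \<cdot>\<^bsub>base Y\<^esub> ((?v1 \<cdot>\<^bsub>base Y\<^esub> ?e1) \<odot>\<^bsub>horiz Y\<^esub> (?v2 \<cdot>\<^bsub>base Y\<^esub> ?e2)) = _")
proof -
  let ?F1 = "on_obj (underlying F) X.one" and ?uY = "Y.one" and ?\<eta> = "unit_map F"
  note u = XV.unit_in_Obj
  have Fa: "Fa \<in> Obj (base Y)" and Fb: "Fb \<in> Obj (base Y)"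
    using FV.on_obj_in_Obj a b by (auto simp: Fa_def Fb_def)
  note iFa = YV.C.Ident_in_hom[OF Fa] and iFb = YV.C.Ident_in_hom[OF Fb]
  note \<eta> = FV.unit_in_hom
  have a1: "a \<otimes>\<^bsub>horiz X\<^esub> X.one = a" and b1: "X.one \<otimes>\<^bsub>horiz X\<^esub> b = b"
    using XH.strict_unit_obj a b by (simp_all add: X.same_unit)
  have Fa1: "Fa \<otimes>\<^bsub>horiz Y\<^esub> ?uY = Fa" and Fb1: "?uY \<otimes>\<^bsub>horiz Y\<^esub> Fb = Fb"
    using YH.strict_unit_obj Fa Fb by (simp_all add: Y.same_unit)
  have v1: "?v1 \<in> hom (base Y) (Fa \<otimes>\<^bsub>vert Y\<^esub> ?F1) (on_obj (underlying F) (a \<otimes>\<^bsub>vert X\<^esub> X.one))"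
    and v2: "?v2 \<in> hom (base Y) (?F1 \<otimes>\<^bsub>vert Y\<^esub> Fb) (on_obj (underlying F) (X.one \<otimes>\<^bsub>vert X\<^esub> b))"
    using FV.mult_in_hom a b u by (auto simp: Fa_def Fb_def)
  have e1: "?e1 \<in> hom (base Y) (Fa \<otimes>\<^bsub>vert Y\<^esub> ?uY) (Fa \<otimes>\<^bsub>vert Y\<^esub> ?F1)"
    by (rule YV.tensor_in_hom[OF iFa \<eta>])
  have e2: "?e2 \<in> hom (base Y) (?uY \<otimes>\<^bsub>vert Y\<^esub> Fb) (?F1 \<otimes>\<^bsub>vert Y\<^esub> Fb)"
    by (rule YV.tensor_in_hom[OF \<eta> iFb])
  have h1: "hmult F a X.one \<in> hom (base Y) (Fa \<otimes>\<^bsub>horiz Y\<^esub> ?F1) Fa"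
    using FH.mult_in_hom[OF a u] by (simp add: a1 Fa_def)
  have h2: "hmult F X.one b \<in> hom (base Y) (?F1 \<otimes>\<^bsub>horiz Y\<^esub> Fb) Fb"
    using FH.mult_in_hom[OF u b] by (simp add: b1 Fb_def)
  have k1: "Ident (base Y) Fa \<odot>\<^bsub>horiz Y\<^esub> ?\<eta> \<in> hom (base Y) Fa (Fa \<otimes>\<^bsub>horiz Y\<^esub> ?F1)"
    using YH.tensor_in_hom[OF iFa \<eta>] by (simp add: Fa1)
  have k2: "?\<eta> \<odot>\<^bsub>horiz Y\<^esub> Ident (base Y) Fb \<in> hom (base Y) Fb (?F1 \<otimes>\<^bsub>horiz Y\<^esub> Fb)"
    using YH.tensor_in_hom[OF \<eta> iFb] by (simp add: Fb1)
  have v: "vmult F a b \<in> hom (base Y) (Fa \<otimes>\<^bsub>vert Y\<^esub> Fb) (on_obj (underlying F) (a \<otimes>\<^bsub>vert X\<^esub> b))"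
    using FV.mult_in_hom[OF a b] by (simp add: Fa_def Fb_def)
  have h: "?h \<in> hom (base Y)
      (on_obj (underlying F) (a \<otimes>\<^bsub>vert X\<^esub> X.one) \<otimes>\<^bsub>horiz Y\<^esub>
       on_obj (underlying F) (X.one \<otimes>\<^bsub>vert X\<^esub> b))
      (on_obj (underlying F) ((a \<otimes>\<^bsub>vert X\<^esub> X.one) \<otimes>\<^bsub>horiz X\<^esub> (X.one \<otimes>\<^bsub>vert X\<^esub> b)))"
    by (rule FH.mult_in_hom[OF XV.tensor_in_Obj[OF a u] XV.tensor_in_Obj[OF u b]])
  have k12: "?e1 \<odot>\<^bsub>horiz Y\<^esub> ?e2
      = (Ident (base Y) Fa \<odot>\<^bsub>horiz Y\<^esub> ?\<eta>) \<odot>\<^bsub>vert Y\<^esub> (?\<eta> \<odot>\<^bsub>horiz Y\<^esub> Ident (base Y) Fb)"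
    by (rule Y.interchange_arr[symmetric])
      (use YV.C.hom_Obj iFa iFb \<eta> in blast)+
  have "?h \<cdot>\<^bsub>base Y\<^esub> ((?v1 \<cdot>\<^bsub>base Y\<^esub> ?e1) \<odot>\<^bsub>horiz Y\<^esub> (?v2 \<cdot>\<^bsub>base Y\<^esub> ?e2))
      = ?h \<cdot>\<^bsub>base Y\<^esub> ((?v1 \<odot>\<^bsub>horiz Y\<^esub> ?v2) \<cdot>\<^bsub>base Y\<^esub> (?e1 \<odot>\<^bsub>horiz Y\<^esub> ?e2))"
    by (simp only: YH.tensor_Comp[OF e1 v1 e2 v2])
  also have "\<dots> = (?h \<cdot>\<^bsub>base Y\<^esub> (?v1 \<odot>\<^bsub>horiz Y\<^esub> ?v2)) \<cdot>\<^bsub>base Y\<^esub> (?e1 \<odot>\<^bsub>horiz Y\<^esub> ?e2)"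
    by (rule YV.C.Comp_assoc[OF YH.tensor_in_hom[OF e1 e2] YH.tensor_in_hom[OF v1 v2] h,
          symmetric])
  also have "?h \<cdot>\<^bsub>base Y\<^esub> (?v1 \<odot>\<^bsub>horiz Y\<^esub> ?v2)
      = vmult F a b \<cdot>\<^bsub>base Y\<^esub> (hmult F a X.one \<odot>\<^bsub>vert Y\<^esub> hmult F X.one b)"
    using mult_interchange[OF a u u b] by (simp add: a1 b1)
  also have "\<dots> \<cdot>\<^bsub>base Y\<^esub> (?e1 \<odot>\<^bsub>horiz Y\<^esub> ?e2)
      = vmult F a b \<cdot>\<^bsub>base Y\<^esub> ((hmult F a X.one \<odot>\<^bsub>vert Y\<^esub> hmult F X.one b) \<cdot>\<^bsub>base Y\<^esub>
         ((Ident (base Y) Fa \<odot>\<^bsub>horiz Y\<^esub> ?\<eta>) \<odot>\<^bsub>vert Y\<^esub> (?\<eta> \<odot>\<^bsub>horiz Y\<^esub> Ident (base Y) Fb)))"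
    unfolding k12
    by (rule YV.C.Comp_assoc[OF YV.tensor_in_hom[OF k1 k2] YV.tensor_in_hom[OF h1 h2] v])
  also have "\<dots> = vmult F a b \<cdot>\<^bsub>base Y\<^esub> (Ident (base Y) Fa \<odot>\<^bsub>vert Y\<^esub> Ident (base Y) Fb)"
    by (simp only: YV.tensor_Comp[OF k1 h1 k2 h2] hmult_unit(1)[OF a, folded Fa_def]
        hmult_unit(2)[OF b, folded Fb_def])
  also have "\<dots> = vmult F a b"
    by (simp only: YV.tensor_Ident[OF Fa Fb] YV.C.Comp_Ident[OF v])
  finally show ?thesis .
qed

text \<open>The vertical unit axioms of \<open>F\<close> rewrite \<open>vert_to_horiz\<close> at \<open>F a, F b\<close> as the image under \<open>F\<close>
  of the unit constraints at \<open>a\<close> and \<open>b\<close>, preceded by comparison maps. Naturality of \<open>hmult F\<close>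
  moves \<open>hmult F\<close> past those images, next to the comparison maps, where
  \<open>hmult_padded_eq_vmult\<close> collapses the composite to \<open>vmult F a b\<close>.\<close>

lemma hmult_vert_to_horiz:
  assumes a: "a \<in> Obj (base X)" and b: "b \<in> Obj (base X)"
  defines "Fa \<equiv> on_obj (underlying F) a" and "Fb \<equiv> on_obj (underlying F) b"
  shows "hmult F a b \<cdot>\<^bsub>base Y\<^esub> Y.vert_to_horiz Fa Fb
       = on_arr (underlying F) (X.vert_to_horiz a b) \<cdot>\<^bsub>base Y\<^esub> vmult F a b"
proof -
  let ?r = "runitor (vert X) a" and ?l = "lunitor (vert X) b" and ?F = "on_arr (underlying F)"
  let ?p1 = "vmult F a X.one \<cdot>\<^bsub>base Y\<^esub> (Ident (base Y) Fa \<odot>\<^bsub>vert Y\<^esub> unit_map F)"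
  let ?p2 = "vmult F X.one b \<cdot>\<^bsub>base Y\<^esub> (unit_map F \<odot>\<^bsub>vert Y\<^esub> Ident (base Y) Fb)"
  let ?Fa1 = "on_obj (underlying F) (a \<otimes>\<^bsub>vert X\<^esub> X.one)"
  let ?F1b = "on_obj (underlying F) (X.one \<otimes>\<^bsub>vert X\<^esub> b)"
  let ?h = "hmult F (a \<otimes>\<^bsub>vert X\<^esub> X.one) (X.one \<otimes>\<^bsub>vert X\<^esub> b)"
  note u = XV.unit_in_Obj
  have Fa: "Fa \<in> Obj (base Y)" and Fb: "Fb \<in> Obj (base Y)"
    using FV.on_obj_in_Obj a b by (auto simp: Fa_def Fb_def)
  note iFa = YV.C.Ident_in_hom[OF Fa] and iFb = YV.C.Ident_in_hom[OF Fb]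
  note r = XV.runitor_in_hom[OF a] and l = XV.lunitor_in_hom[OF b]
  note Fr = FV.on_arr_in_hom[OF r, folded Fa_def] and Fl = FV.on_arr_in_hom[OF l, folded Fb_def]
  note v1 = FV.mult_in_hom[OF a u, folded Fa_def] and v2 = FV.mult_in_hom[OF u b, folded Fb_def]
  note e1 = YV.tensor_in_hom[OF iFa FV.unit_in_hom]
    and e2 = YV.tensor_in_hom[OF FV.unit_in_hom iFb]
  note p1 = YV.C.Comp_in_hom[OF e1 v1] and p2 = YV.C.Comp_in_hom[OF e2 v2]
  have rF: "runitor (vert Y) Fa = ?F ?r \<cdot>\<^bsub>base Y\<^esub> ?p1"
    using FV.mult_runit[OF a, folded Fa_def] YV.C.Comp_assoc[OF e1 v1 Fr] by simp
  have lF: "lunitor (vert Y) Fb = ?F ?l \<cdot>\<^bsub>base Y\<^esub> ?p2"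
    using FV.mult_lunit[OF b, folded Fb_def] YV.C.Comp_assoc[OF e2 v2 Fl] by simp
  note pp = YH.tensor_in_hom[OF p1 p2] and FrFl = YH.tensor_in_hom[OF Fr Fl]
  have hab: "hmult F a b \<in> hom (base Y) (Fa \<otimes>\<^bsub>horiz Y\<^esub> Fb)
      (on_obj (underlying F) (a \<otimes>\<^bsub>horiz X\<^esub> b))"
    using FH.mult_in_hom[OF a b] by (simp add: Fa_def Fb_def)
  note h = FH.mult_in_hom[OF XV.tensor_in_Obj[OF a u] XV.tensor_in_Obj[OF u b]]
  note Frl = FV.on_arr_in_hom[OF XH.tensor_in_hom[OF r l]]
  have "hmult F a b \<cdot>\<^bsub>base Y\<^esub> Y.vert_to_horiz Fa Fb
      = hmult F a b \<cdot>\<^bsub>base Y\<^esub> ((?F ?r \<odot>\<^bsub>horiz Y\<^esub> ?F ?l) \<cdot>\<^bsub>base Y\<^esub> (?p1 \<odot>\<^bsub>horiz Y\<^esub> ?p2))"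
    unfolding Y.vert_to_horiz_def rF lF by (simp only: YH.tensor_Comp[OF p1 Fr p2 Fl])
  also have "\<dots> = (hmult F a b \<cdot>\<^bsub>base Y\<^esub> (?F ?r \<odot>\<^bsub>horiz Y\<^esub> ?F ?l)) \<cdot>\<^bsub>base Y\<^esub> (?p1 \<odot>\<^bsub>horiz Y\<^esub> ?p2)"
    by (rule YV.C.Comp_assoc[OF pp FrFl hab, symmetric])
  also have "\<dots> = (?F (?r \<odot>\<^bsub>horiz X\<^esub> ?l) \<cdot>\<^bsub>base Y\<^esub> ?h) \<cdot>\<^bsub>base Y\<^esub> (?p1 \<odot>\<^bsub>horiz Y\<^esub> ?p2)"
    by (simp only: FH.mult_natural[OF r l])
  also have "\<dots> = ?F (?r \<odot>\<^bsub>horiz X\<^esub> ?l) \<cdot>\<^bsub>base Y\<^esub> (?h \<cdot>\<^bsub>base Y\<^esub> (?p1 \<odot>\<^bsub>horiz Y\<^esub> ?p2))"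
    by (rule YV.C.Comp_assoc[OF pp h Frl])
  also have "?h \<cdot>\<^bsub>base Y\<^esub> (?p1 \<odot>\<^bsub>horiz Y\<^esub> ?p2) = vmult F a b"
    unfolding Fa_def Fb_def by (rule hmult_padded_eq_vmult[OF a b])
  finally show ?thesis by (simp only: X.vert_to_horiz_def)
qed

end

theorem proposition3p8:
  fixes X :: "('o, 'm) dd_structure" and Y :: "('p, 'n) dd_structure"
    and F G :: "('o, 'm, 'p, 'n) weak_map_data" and \<theta> :: "'o \<Rightarrow> 'n"
  assumes "dd_Bicat\<^sub>s_category X" and "dd_Bicat\<^sub>s_category Y"
    and "weak_map X Y F" and "weak_map X Y G"
    and "V_transformation X Y F G \<theta>"
  shows "H_transformation X Y F G \<theta>"
proof -
  interpret X: dd_Bicat\<^sub>s_category X by fact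
  interpret Y: dd_Bicat\<^sub>s_category Y by fact
  interpret F: weak_map X Y F by fact
  interpret G: weak_map X Y G by fact
  interpret V: monoidal_transformation "base X" "vert X" "base Y" "vert Y"
      "underlying F" "vmult F" "unit_map F" "underlying G" "vmult G" "unit_map G" \<theta>
    using assms(5) by (simp only: V_transformation_def)
  interpret FH: monoidal_functor "base X" "horiz X" "base Y" "horiz Y"
      "underlying F" "hmult F" "unit_map F"
    by (rule F.horiz_monoidal_functor)
  interpret GH: monoidal_functor "base X" "horiz X" "base Y" "horiz Y"
      "underlying G" "hmult G" "unit_map G"
    by (rule G.horiz_monoidal_functor)
  have mult: "\<theta> (a \<otimes>\<^bsub>horiz X\<^esub> b) \<cdot>\<^bsub>base Y\<^esub> hmult F a b
      = hmult G a b \<cdot>\<^bsub>base Y\<^esub> (\<theta> a \<odot>\<^bsub>horiz Y\<^esub> \<theta> b)"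
    if a: "a \<in> Obj (base X)" and b: "b \<in> Obj (base X)" for a b
  proof -
    let ?F = "on_obj (underlying F)" and ?G = "on_obj (underlying G)"
    note Fa = V.F.on_obj_in_Obj[OF a] and Fb = V.F.on_obj_in_Obj[OF b]
      and Ga = V.G.on_obj_in_Obj[OF a] and Gb = V.G.on_obj_in_Obj[OF b]
    note ta = V.component_in_hom[OF a] and tb = V.component_in_hom[OF b]
    note tab = V.component_in_hom[OF FH.C.tensor_in_Obj[OF a b]]
      and tv = V.component_in_hom[OF V.F.C.tensor_in_Obj[OF a b]]
    note xi = X.vert_to_horiz_in_hom[OF a b]
      and xiF = Y.vert_to_horiz_in_hom[OF Fa Fb] and xiG = Y.vert_to_horiz_in_hom[OF Ga Gb]
    note hF = FH.mult_in_hom[OF a b] and hG = GH.mult_in_hom[OF a b]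
    note vF = V.F.mult_in_hom[OF a b] and vG = V.G.mult_in_hom[OF a b]
    note assoc = V.F.D.C.Comp_assoc
    note ttH = FH.D.tensor_in_hom[OF ta tb] and ttV = V.F.D.tensor_in_hom[OF ta tb]
    have "(\<theta> (a \<otimes>\<^bsub>horiz X\<^esub> b) \<cdot>\<^bsub>base Y\<^esub> hmult F a b) \<cdot>\<^bsub>base Y\<^esub> Y.vert_to_horiz (?F a) (?F b)
        = \<theta> (a \<otimes>\<^bsub>horiz X\<^esub> b) \<cdot>\<^bsub>base Y\<^esub>
            (on_arr (underlying F) (X.vert_to_horiz a b) \<cdot>\<^bsub>base Y\<^esub> vmult F a b)"
      by (simp only: assoc[OF xiF hF tab] F.hmult_vert_to_horiz[OF a b])
    also have "\<dots> = (on_arr (underlying G) (X.vert_to_horiz a b) \<cdot>\<^bsub>base Y\<^esub> \<theta> (a \<otimes>\<^bsub>vert X\<^esub> b))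
            \<cdot>\<^bsub>base Y\<^esub> vmult F a b"
      by (simp only: assoc[OF vF V.F.on_arr_in_hom[OF xi] tab, symmetric] V.naturality[OF xi])
    also have "\<dots> = on_arr (underlying G) (X.vert_to_horiz a b) \<cdot>\<^bsub>base Y\<^esub>
            (vmult G a b \<cdot>\<^bsub>base Y\<^esub> (\<theta> a \<odot>\<^bsub>vert Y\<^esub> \<theta> b))"
      by (simp only: assoc[OF vF tv V.G.on_arr_in_hom[OF xi]] V.respects_mult[OF a b])
    also have "\<dots> = (hmult G a b \<cdot>\<^bsub>base Y\<^esub> Y.vert_to_horiz (?G a) (?G b))
            \<cdot>\<^bsub>base Y\<^esub> (\<theta> a \<odot>\<^bsub>vert Y\<^esub> \<theta> b)"
      by (simp only: assoc[OF ttV vG V.G.on_arr_in_hom[OF xi], symmetric]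
          G.hmult_vert_to_horiz[OF a b])
    also have "\<dots> = hmult G a b \<cdot>\<^bsub>base Y\<^esub>
            ((\<theta> a \<odot>\<^bsub>horiz Y\<^esub> \<theta> b) \<cdot>\<^bsub>base Y\<^esub> Y.vert_to_horiz (?F a) (?F b))"
      by (simp only: assoc[OF ttV xiG hG] Y.vert_to_horiz_natural[OF ta tb])
    also have "\<dots> = (hmult G a b \<cdot>\<^bsub>base Y\<^esub> (\<theta> a \<odot>\<^bsub>horiz Y\<^esub> \<theta> b))
            \<cdot>\<^bsub>base Y\<^esub> Y.vert_to_horiz (?F a) (?F b)"
      by (rule assoc[OF xiF ttH hG, symmetric])
    finally show ?thesis
      by (rule V.F.D.C.iso_arrow_epi[OF Y.vert_to_horiz_iso[OF Fa Fb] xiF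
            V.F.D.C.Comp_in_hom[OF hF tab] V.F.D.C.Comp_in_hom[OF ttH hG]])
  qed
  show ?thesis
    unfolding H_transformation_def
  proof unfold_locales
    show "\<theta> (unit_obj (horiz X)) \<cdot>\<^bsub>base Y\<^esub> unit_map F = unit_map G"
      using V.respects_unit by (simp only: X.same_unit)
  qed (rule mult)
qed

end
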